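(* Let $G$ be a finite group and let $H$ be a normal subgroup of $G$. If $G/H$ has an equal covering, then $G$ has an equal covering.
   Context: A covering of a group $G$ is a collection of proper subgroups of $G$ whose set-theoretic union is $G$. An equal covering of $G$ is a covering of $G$ all of whose members have the same order. *)

theory Defs
  imports "HOL-Algebra.Algebra"
begin

definition covering :: "('a, 'b) monoid_scheme \<Rightarrow> 'a set set \<Rightarrow> bool" where
  "covering G \<C> \<longleftrightarrow>
     (\<forall>K\<in>\<C>. subgroup K G \<and> K \<noteq> carrier G) \<and> \<Union>\<C> = carrier G"

(* The order of a subgroup is card, so this is meaningful for finite groups only:
   card identifies all infinite subgroups. *)
definition equal_covering :: "('a, 'b) monoid_scheme \<Rightarrow> 'a set set \<Rightarrow> bool" where
  "equal_covering G \<C> \<longleftrightarrow>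
     covering G \<C> \<and> (\<forall>K\<in>\<C>. \<forall>L\<in>\<C>. card K = card L)"

end

(* The unions of the cosets in the members of an equal covering of G/H are their preimages
   under G \<rightarrow> G/H. These are proper subgroups covering G, and each has card H times
   the order of the corresponding subgroup of G/H. *)
theory Submission
  imports Defs
begin

text \<open>The members of \<open>K\<close> are pairwise disjoint cosets of \<open>H\<close>, each
  with \<open>card H\<close> elements, so they partition \<open>\<Union>K\<close> into blocks of
  equal size.\<close>

lemma (in normal) card_Union_factgroup_subgroup:
  assumes "finite (carrier G)" and "subgroup K (G Mod H)"
  shows "card (\<Union>K) = card H * card K"
proof -
  have K: "K \<subseteq> rcosets H"
    using subgroup.subset[OF assms(2)] by (simp add: FactGroup_def)
  \<comment> \<open>The cosets have union \<open>carrier G\<close>, and a family of sets with finite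
    union is finite.\<close>
  have fin: "finite (rcosets H)"
    using assms(1) by (simp add: finite_UnionD rcosets_part_G[OF is_subgroup])
  have "card H * card K = card (\<Union>K)"
  proof (rule card_partition)
    show "finite K"
      using K fin by (rule finite_subset)
    show "finite (\<Union>K)"
      using Union_mono[OF K] assms(1) unfolding rcosets_part_G[OF is_subgroup] by (rule finite_subset)
    show "card c = card H" if "c \<in> K" for c
      using card_rcosets_equal[OF _ subset] K that by auto
    show "c \<inter> d = {}" if "c \<in> K" "d \<in> K" "c \<noteq> d" for c d
      using rcos_disjoint[OF is_subgroup] K that by (auto simp: pairwise_def disjnt_def)
  qed
  then show ?thesis by simp
qed

text \<open>An element \<open>x\<close> lies in \<open>\<Union>K\<close> only if its whole coset
  \<open>H #> x\<close> is a member of \<open>K\<close>; so if \<open>\<Union>K\<close> were all of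
  \<open>G\<close>, then \<open>K\<close> would contain every coset.\<close>

lemma (in normal) Union_factgroup_subgroup_proper:
  assumes "subgroup K (G Mod H)" and "K \<noteq> carrier (G Mod H)"
  shows "\<Union>K \<noteq> carrier G"
proof
  assume "\<Union>K = carrier G"
  then have "H #> x \<in> K" if "x \<in> carrier G" for x
    using factgroup_subgroup_union_char[OF assms(1)] that by blast
  then have "carrier (G Mod H) \<subseteq> K"
    by (auto simp: FactGroup_def RCOSETS_def)
  with subgroup.subset[OF assms(1)] assms(2) show False
    by simp
qed

theorem theorem19:
  fixes G :: "('a, 'b) monoid_scheme" and H :: "'a set"
  assumes "group G"
    and "finite (carrier G)"
    and "H \<lhd> G"
    and "\<exists>\<C>. equal_covering (G Mod H) \<C>"
  shows "\<exists>\<D>. equal_covering G \<D>"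
proof -
  interpret normal H G by fact
  obtain \<C> where \<C>: "equal_covering (G Mod H) \<C>"
    using assms(4) ..
  have sub: "subgroup K (G Mod H)" and proper: "K \<noteq> carrier (G Mod H)" if "K \<in> \<C>" for K
    using \<C> that by (simp_all add: equal_covering_def covering_def)
  have cover: "\<Union>\<C> = carrier (G Mod H)"
    using \<C> by (simp add: equal_covering_def covering_def)
  have eq: "card K = card L" if "K \<in> \<C>" "L \<in> \<C>" for K L
    using \<C> that unfolding equal_covering_def by blast
  \<comment> \<open>Uniting the members of \<open>\<C>\<close> first gives the set of all cosets,
    whose union is \<open>G\<close>.\<close>
  have "\<Union>(Union ` \<C>) = \<Union>(\<Union>\<C>)"
    by blast
  also have "\<dots> = carrier G"
    using cover rcosets_part_G[OF is_subgroup] by (simp add: FactGroup_def)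
  finally have "covering G (Union ` \<C>)"
    unfolding covering_def by (simp add: factgroup_subgroup_union_subgroup[OF sub] Union_factgroup_subgroup_proper[OF sub proper])
  \<comment> \<open>The factor \<open>card H\<close> is the same for all members, so equal orders in
    the quotient lift to equal orders in \<open>G\<close>.\<close>
  moreover have "card (\<Union>K) = card (\<Union>L)" if "K \<in> \<C>" "L \<in> \<C>" for K L
    by (simp only: card_Union_factgroup_subgroup[OF assms(2) sub] that eq[OF that])
  ultimately have "equal_covering G (Union ` \<C>)"
    unfolding equal_covering_def by blast
  then show ?thesis ..
qed

end
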